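(* Let $(X,\tau)$ and $(Y,\sigma)$ be topological spaces and let $f \colon (X,\tau) \rightarrow (Y,\sigma)$ be a function. The following conditions are equivalent: (1) $f$ is completely continuous. (2) $f$ is precontinuous, $\mathcal{B}$-continuous and contra-gs-continuous.
   Context: No separation axioms are assumed and functions are not assumed continuous. For a subset $A$ of a topological space, $\mathrm{Int}(A)$ and $\mathrm{Cl}(A)$ denote interior and closure. $A$ is semi-open if $A \subseteq \mathrm{Cl}(\mathrm{Int}(A))$; semi-closed if its complement is semi-open (equivalently $\mathrm{Int}(\mathrm{Cl}(A)) \subseteq A$); regular open if $A = \mathrm{Int}(\mathrm{Cl}(A))$; preopen if $A \subseteq \mathrm{Int}(\mathrm{Cl}(A))$. $A$ is a $\mathcal{B}$-set if it is the intersection of an open set and a semi-closed set. The semi-closure $\mathrm{sCl}(A)$ is the intersection of all semi-closed sets containing $A$. $A$ is gs-closed if $\mathrm{sCl}(A) \subseteq U$ whenever $A \subseteq U$ and $U$ is open. A function $f \colon (X,\tau)\to(Y,\sigma)$ is completely continuous (resp. precontinuous, $\mathcal{B}$-continuous, contra-gs-continuous) if the preimage of every open subset of $Y$ is regular open (resp. preopen, a $\mathcal{B}$-set, gs-closed) in $X$. *)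

theory Defs
  imports "HOL-Analysis.Abstract_Topology"
begin

definition semi_open :: "'a topology \<Rightarrow> 'a set \<Rightarrow> bool" where
  "semi_open X A \<longleftrightarrow> A \<subseteq> topspace X \<and> A \<subseteq> X closure_of (X interior_of A)"

definition semi_closed :: "'a topology \<Rightarrow> 'a set \<Rightarrow> bool" where
  "semi_closed X A \<longleftrightarrow> A \<subseteq> topspace X \<and> semi_open X (topspace X - A)"

definition regular_open :: "'a topology \<Rightarrow> 'a set \<Rightarrow> bool" where
  "regular_open X A \<longleftrightarrow> A \<subseteq> topspace X \<and> A = X interior_of (X closure_of A)"

definition preopen :: "'a topology \<Rightarrow> 'a set \<Rightarrow> bool" where
  "preopen X A \<longleftrightarrow> A \<subseteq> topspace X \<and> A \<subseteq> X interior_of (X closure_of A)"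

definition B_set :: "'a topology \<Rightarrow> 'a set \<Rightarrow> bool" where
  "B_set X A \<longleftrightarrow> (\<exists>U F. openin X U \<and> semi_closed X F \<and> A = U \<inter> F)"

text \<open>Only meaningful for subsets of the space: otherwise the family below is empty and its
  intersection is the whole type.\<close>

definition semi_closure :: "'a topology \<Rightarrow> 'a set \<Rightarrow> 'a set" where
  "semi_closure X A = \<Inter> {F. semi_closed X F \<and> A \<subseteq> F}"

definition gs_closed :: "'a topology \<Rightarrow> 'a set \<Rightarrow> bool" where
  "gs_closed X A \<longleftrightarrow> A \<subseteq> topspace X \<and> (\<forall>U. openin X U \<and> A \<subseteq> U \<longrightarrow> semi_closure X A \<subseteq> U)"

text \<open>As functions are total on the type, preimages are cut down to the domain space. The map
  properties below constrain preimages only; that \<open>f\<close> maps \<open>topspace X\<close> into \<open>topspace Y\<close> is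
  to be assumed separately.\<close>

definition completely_continuous :: "'a topology \<Rightarrow> 'b topology \<Rightarrow> ('a \<Rightarrow> 'b) \<Rightarrow> bool" where
  "completely_continuous X Y f \<longleftrightarrow>
     (\<forall>V. openin Y V \<longrightarrow> regular_open X {x \<in> topspace X. f x \<in> V})"

definition precontinuous :: "'a topology \<Rightarrow> 'b topology \<Rightarrow> ('a \<Rightarrow> 'b) \<Rightarrow> bool" where
  "precontinuous X Y f \<longleftrightarrow>
     (\<forall>V. openin Y V \<longrightarrow> preopen X {x \<in> topspace X. f x \<in> V})"

definition B_continuous :: "'a topology \<Rightarrow> 'b topology \<Rightarrow> ('a \<Rightarrow> 'b) \<Rightarrow> bool" where
  "B_continuous X Y f \<longleftrightarrow>
     (\<forall>V. openin Y V \<longrightarrow> B_set X {x \<in> topspace X. f x \<in> V})"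

definition contra_gs_continuous :: "'a topology \<Rightarrow> 'b topology \<Rightarrow> ('a \<Rightarrow> 'b) \<Rightarrow> bool" where
  "contra_gs_continuous X Y f \<longleftrightarrow>
     (\<forall>V. openin Y V \<longrightarrow> gs_closed X {x \<in> topspace X. f x \<in> V})"

end

theory Submission
  imports Defs
begin

text \<open>A preopen \<open>\<B>\<close>-set \<open>A = U \<inter> F\<close> is open, because \<open>A \<subseteq> Int (Cl A) \<subseteq> Int (Cl F) \<subseteq> F\<close> gives
  \<open>A = U \<inter> Int (Cl A)\<close>. An open gs-closed set contains its own semi-closure, and the semi-closure of
  \<open>A\<close> contains \<open>Int (Cl A)\<close>. Conversely, a regular open set is semi-closed, hence equal to its
  semi-closure.\<close>

text \<open>Complementation in \<open>topspace X\<close> swaps interior and closure, and it reverses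
  inclusions between subsets of the space.\<close>

lemma semi_closed_iff:
  "semi_closed X F \<longleftrightarrow> F \<subseteq> topspace X \<and> X interior_of (X closure_of F) \<subseteq> F"
proof -
  have "X closure_of (X interior_of (topspace X - F)) = topspace X - X interior_of (X closure_of F)"
    by (simp add: interior_of_complement closure_of_complement)
  then show ?thesis
    using interior_of_subset_topspace[of X "X closure_of F"]
    unfolding semi_closed_def semi_open_def by blast
qed

lemma interior_of_closure_of_mono:
  "A \<subseteq> B \<Longrightarrow> X interior_of (X closure_of A) \<subseteq> X interior_of (X closure_of B)"
  by (intro interior_of_mono closure_of_mono)

text \<open>Every semi-closed superset F of A absorbs Int (Cl F), which contains Int (Cl A) by
  monotonicity. If A has no such superset, the intersection is the whole type and the inclusion is
  trivial.\<close>

lemma interior_of_closure_of_subset_semi_closure: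
  "X interior_of (X closure_of A) \<subseteq> semi_closure X A"
  unfolding semi_closure_def semi_closed_iff
proof (intro Inter_greatest)
  fix F
  assume "F \<in> {F. (F \<subseteq> topspace X \<and> X interior_of (X closure_of F) \<subseteq> F) \<and> A \<subseteq> F}"
  then show "X interior_of (X closure_of A) \<subseteq> F"
    using interior_of_closure_of_mono[of A F X] by blast
qed

lemma preopen_B_set_imp_openin:
  assumes "preopen X A" "B_set X A"
  shows "openin X A"
proof -
  obtain U F where U: "openin X U" and F: "semi_closed X F" and A: "A = U \<inter> F"
    using assms(2) unfolding B_set_def by blast
  have "X interior_of (X closure_of A) \<subseteq> F"
    using F interior_of_closure_of_mono[of A F X] A unfolding semi_closed_iff by blast
  moreover have "A \<subseteq> X interior_of (X closure_of A)"
    using assms(1) unfolding preopen_def by blast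
  ultimately have "A = U \<inter> X interior_of (X closure_of A)"
    using A by blast
  moreover have "openin X (U \<inter> X interior_of (X closure_of A))"
    using U by (intro openin_Int openin_interior_of)
  ultimately show ?thesis by simp
qed

lemma regular_open_iff:
  "regular_open X A \<longleftrightarrow> preopen X A \<and> B_set X A \<and> gs_closed X A"
proof
  assume A: "regular_open X A"
  then have sub: "A \<subseteq> topspace X" and eq: "X interior_of (X closure_of A) = A"
    unfolding regular_open_def by metis+
  have sc: "semi_closed X A"
    unfolding semi_closed_iff using sub eq by simp
  \<comment> \<open>The whole space serves as the open factor and A itself as the semi-closed
    one.\<close>
  have "A = topspace X \<inter> A"
    using sub by blast
  then have "B_set X A"
    unfolding B_set_def using sc by blast
  \<comment> \<open>A is itself a member of the family being intersected.\<close>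
  moreover have "semi_closure X A \<subseteq> A"
    unfolding semi_closure_def using sc by blast
  ultimately show "preopen X A \<and> B_set X A \<and> gs_closed X A"
    using sub eq unfolding preopen_def gs_closed_def by blast
next
  assume A: "preopen X A \<and> B_set X A \<and> gs_closed X A"
  \<comment> \<open>Since A is open, the gs-closed condition may be applied with U = A.\<close>
  then have "semi_closure X A \<subseteq> A"
    using preopen_B_set_imp_openin[of X A] unfolding gs_closed_def by simp
  then have "X interior_of (X closure_of A) \<subseteq> A"
    using interior_of_closure_of_subset_semi_closure[of X A] by simp
  then show "regular_open X A"
    using A unfolding regular_open_def preopen_def by (simp add: subset_antisym)
qed

theorem corollary3p16:
  fixes X :: "'a topology" and Y :: "'b topology" and f :: "'a \<Rightarrow> 'b"
  assumes "f \<in> topspace X \<rightarrow> topspace Y"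
  shows "completely_continuous X Y f \<longleftrightarrow>
         precontinuous X Y f \<and> B_continuous X Y f \<and> contra_gs_continuous X Y f"
  \<comment> \<open>The set-level equivalence holds for the preimage of each open V, and the
    universal quantifier over V distributes over the conjunction.\<close>
  unfolding completely_continuous_def precontinuous_def B_continuous_def
    contra_gs_continuous_def regular_open_iff
  by blast

end
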